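(* Let $r$ be a positive integer and $a\in(-1,1)$. Let $g(a)=\frac{\pi}{4}\cdot\frac{1+\tan(\frac\pi4a)}{1-\tan(\frac\pi4a)}$, with $g^{(r-1)}$ its $(r-1)$-th derivative. Then $$\sum_{j=1}^\infty\frac{(r-1)!\,(-1)^{r(j+1)}}{\big((2j-1)+(-1)^ja\big)^r}=g^{(r-1)}(a).$$
   Context: For $r=1$ the series is understood as the limit of its partial sums in the order of increasing $j$; $g^{(0)}=g$. *)

theory Defs
  imports "HOL-Analysis.Analysis"
begin

definition g :: "real \<Rightarrow> real" where
  "g a = pi / 4 * ((1 + tan (pi / 4 * a)) / (1 - tan (pi / 4 * a)))"

definition series_term :: "nat \<Rightarrow> real \<Rightarrow> nat \<Rightarrow> real" where
  "series_term r a j =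
     fact (r - 1) * (-1) ^ (r * (j + 1)) / ((2 * real j - 1) + (-1) ^ j * a) ^ r"

end

theory Submission
  imports Defs
begin

text \<open>
  Put \<open>x = (1 - a) / 4\<close>, so that \<open>1 - x = (3 + a) / 4\<close>.  The denominators are
  \<open>4 * (k + x)\<close> for \<open>j = 2 * k + 1\<close> and \<open>4 * (k + (1 - x))\<close> for \<open>j = 2 * k + 2\<close>, and the
  latter carry the sign \<open>(-1) ^ r\<close>.  Up to the factor \<open>(-1) ^ r / fact (r - 1)\<close>, the sums of
  \<open>1 / (k + x) ^ r\<close> and \<open>1 / (k + (1 - x)) ^ r\<close> over \<open>k\<close> are the classical expansions of
  \<open>Polygamma (r - 1)\<close> at \<open>x\<close> and at \<open>1 - x\<close>.  For \<open>r = 1\<close> both diverge, but the logarithms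
  in the limit formula of the Digamma function cancel in the difference;
  \<open>paired_inverse_powers_sums\<close> treats all \<open>r\<close> at once.

  On the other side, \<open>g a = pi / 4 * tan (pi / 4 * (1 + a)) = pi / 4 * cot (pi * x)\<close>, and the
  reflection formula identifies this with a quarter of \<open>Digamma (1 - x) - Digamma x\<close>.
  Differentiating \<open>r - 1\<close> times in \<open>a\<close> (\<open>higher_deriv_g\<close>) gives the same combination of
  Polygamma values.  Since the terms of the series tend to zero, summing it in consecutive
  pairs does not change its sum (\<open>sums_from_consecutive_pairs\<close>).
\<close>

text \<open>
  The partial sums of even length are the partial sums of the paired series; those of odd
  length differ from them by a single term, so it is enough that the terms of even index
  vanish in the limit.
\<close>
lemma sums_from_consecutive_pairs:
  fixes f :: "nat \<Rightarrow> 'a :: real_normed_vector"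
  assumes pairs: "(\<lambda>k. f (2 * k) + f (2 * k + 1)) sums s"
    and null: "(\<lambda>k. f (2 * k)) \<longlonglongrightarrow> 0"
  shows "f sums s"
proof -
  define S where "S n = (\<Sum>i<n. f i)" for n
  have S_double: "S (2 * m) = (\<Sum>k<m. f (2 * k) + f (2 * k + 1))" for m
    by (induction m) (simp_all add: S_def)
  have even: "(\<lambda>m. S (2 * m)) \<longlonglongrightarrow> s"
    using pairs by (simp add: S_double sums_def)
  have "(\<lambda>m. S (2 * m) + f (2 * m)) \<longlonglongrightarrow> s + 0"
    by (intro tendsto_add even null)
  then have odd: "(\<lambda>m. S (2 * m + 1)) \<longlonglongrightarrow> s"
    by (simp add: S_def)
  have "S \<longlonglongrightarrow> s"
  proof (rule LIMSEQ_I)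
    fix e :: real
    assume "e > 0"
    obtain M where M: "\<And>m. m \<ge> M \<Longrightarrow> norm (S (2 * m) - s) < e"
      using LIMSEQ_D[OF even \<open>e > 0\<close>] by blast
    obtain N where N: "\<And>m. m \<ge> N \<Longrightarrow> norm (S (2 * m + 1) - s) < e"
      using LIMSEQ_D[OF odd \<open>e > 0\<close>] by blast
    have "norm (S n - s) < e" if "n \<ge> 2 * (M + N) + 1" for n
    proof (cases "even n")
      case True
      then obtain m where "n = 2 * m" by blast
      with that M show ?thesis by simp
    next
      case False
      then obtain m where "n = 2 * m + 1" by (rule oddE)
      with that N show ?thesis by simp
    qed
    then show "\<exists>n0. \<forall>n\<ge>n0. norm (S n - s) < e" by blast
  qed
  then show ?thesis by (simp add: sums_def S_def[abs_def])
qed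

text \<open>
  Logarithmic differentiation of Euler's reflection formula for the Gamma function.  Over the
  complex numbers that formula is an equality of total functions, so that it can be
  differentiated without restricting it to a neighbourhood of \<open>z\<close>.
\<close>
lemma Digamma_reflection_complex:
  fixes z :: complex
  assumes "z \<notin> \<int>"
  shows "Digamma (1 - z) - Digamma z = of_real pi * cot (of_real pi * z)"
proof -
  have "1 - z \<notin> \<int>"
    using assms Ints_diff[OF Ints_1, of "1 - z"] by auto
  then have z: "z \<notin> \<int>\<^sub>\<le>\<^sub>0" "1 - z \<notin> \<int>\<^sub>\<le>\<^sub>0"
    using assms nonpos_Ints_Int by blast+
  let ?P = "Gamma z * Gamma (1 - z)"
  have P: "?P \<noteq> 0"
    using z by (simp add: Gamma_eq_zero_iff)
  then have sin: "sin (of_real pi * z) \<noteq> 0"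
    unfolding Gamma_reflection_complex by auto
  have "((\<lambda>w. Gamma w * Gamma (1 - w)) has_field_derivative
      ?P * (Digamma z - Digamma (1 - z))) (at z)"
    using z by (auto intro!: derivative_eq_intros simp: algebra_simps)
  moreover have "((\<lambda>w. of_real pi / sin (of_real pi * w)) has_field_derivative
      - (of_real pi / sin (of_real pi * z)) * (of_real pi * cot (of_real pi * z))) (at z)"
    using sin by (auto intro!: derivative_eq_intros simp: cot_def field_simps)
  ultimately have "?P * (Digamma z - Digamma (1 - z)) = - ?P * (of_real pi * cot (of_real pi * z))"
    unfolding Gamma_reflection_complex by (rule DERIV_unique)
  then have "?P * (Digamma (1 - z) - Digamma z) = ?P * (of_real pi * cot (of_real pi * z))"
    by (simp add: algebra_simps)
  with P show ?thesis by simp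
qed

lemma Digamma_reflection_real:
  fixes x :: real
  assumes "x \<notin> \<int>"
  shows "Digamma (1 - x) - Digamma x = pi * cot (pi * x)"
proof -
  have "x \<noteq> 0" "1 - x \<noteq> 0"
    using assms by auto
  then have "Digamma (complex_of_real x) = of_real (Digamma x)"
    and "Digamma (1 - complex_of_real x) = of_real (Digamma (1 - x))"
    using Polygamma_of_real[of "1 - x" 0, where ?'a = complex]
    by (simp_all add: Polygamma_of_real)
  then have "complex_of_real (Digamma (1 - x) - Digamma x) = of_real (pi * cot (pi * x))"
    using Digamma_reflection_complex[of "of_real x"] assms
    by (simp add: cot_of_real)
  then show ?thesis by (simp only: of_real_eq_iff)
qed

text \<open>
  For \<open>n > 0\<close> both series converge.  For \<open>n = 0\<close> they do not, but the partial sums of each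
  differ from the negated Digamma value by the same logarithm, up to a null sequence.
\<close>
lemma paired_inverse_powers_sums:
  fixes x y :: real
  assumes "x > 0" "y > 0"
  shows "(\<lambda>k. inverse ((x + of_nat k) ^ Suc n) + (-1) ^ Suc n * inverse ((y + of_nat k) ^ Suc n))
    sums ((Polygamma n y - (-1) ^ n * Polygamma n x) / fact n)"
proof (cases "n = 0")
  case True
  have "(\<lambda>m. (ln (real m) - (\<Sum>k<m. inverse (y + of_nat k)))
            - (ln (real m) - (\<Sum>k<m. inverse (x + of_nat k))))
        \<longlonglongrightarrow> Digamma y - Digamma x"
    using assms Digamma_LIMSEQ[of x] Digamma_LIMSEQ[of y] by (intro tendsto_diff) auto
  then show ?thesis
    using True by (simp add: sums_def sum_subtractf)
next
  case False
  have x: "(\<lambda>k. inverse ((x + of_nat k) ^ Suc n)) sums ((-1) ^ Suc n * Polygamma n x / fact n)"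
    using assms False by (intro Polygamma_LIMSEQ) auto
  have y: "(\<lambda>k. inverse ((y + of_nat k) ^ Suc n)) sums ((-1) ^ Suc n * Polygamma n y / fact n)"
    using assms False by (intro Polygamma_LIMSEQ) auto
  from sums_add[OF x sums_mult[OF y, of "(-1) ^ Suc n"]] show ?thesis
    by (simp add: diff_divide_distrib flip: power_mult_distrib)
qed

text \<open>
  The quotient in \<open>g\<close> is the addition theorem for \<open>tan (pi / 4 + pi / 4 * a)\<close>.
\<close>
lemma g_eq_cot:
  assumes "a \<in> {-1<..<1}"
  shows "g a = pi / 4 * cot (pi * ((1 - a) / 4))"
proof -
  have "\<bar>pi / 4 * a\<bar> < pi / 4" "\<bar>pi / 4 * (1 + a)\<bar> < pi / 2"
    using assms by (auto simp: abs_mult)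
  then have "cos (pi / 4 * a) \<noteq> 0" "cos (pi / 4 + pi / 4 * a) \<noteq> 0"
    by (auto intro!: less_imp_neq[THEN not_sym] cos_gt_zero_pi simp: algebra_simps)
  then have "tan (pi / 4 + pi / 4 * a) = (1 + tan (pi / 4 * a)) / (1 - tan (pi / 4 * a))"
    by (subst tan_add) (simp_all add: tan_45 cos_45)
  moreover have "pi / 4 + pi / 4 * a = pi / 2 - pi * ((1 - a) / 4)"
    by (simp add: field_simps)
  ultimately show ?thesis
    by (simp only: g_def tan_cot')
qed

text \<open>
  The inner derivatives are \<open>1 / 4\<close> at \<open>(3 + a) / 4\<close> and \<open>- 1 / 4\<close> at \<open>(1 - a) / 4\<close>: every
  differentiation contributes a factor \<open>1 / 4\<close> and flips the sign of the second summand.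
\<close>
lemma higher_deriv_g:
  assumes "a \<in> {-1<..<1}"
  shows "(deriv ^^ n) g a =
    (Polygamma n ((3 + a) / 4) - (-1) ^ n * Polygamma n ((1 - a) / 4)) / 4 ^ Suc n"
  using assms
proof (induction n arbitrary: a)
  case 0
  have "(1 - a) / 4 \<notin> \<int>"
  proof
    assume "(1 - a) / 4 \<in> \<int>"
    then obtain k :: int where k: "(1 - a) / 4 = of_int k" by (elim Ints_cases)
    have "0 < (1 - a) / 4" "(1 - a) / 4 < 1"
      using 0 by auto
    then show False unfolding k by simp
  qed
  from Digamma_reflection_real[OF this] show ?case
    using g_eq_cot[OF 0] by (simp add: field_simps)
next
  case (Suc n)
  have "\<forall>\<^sub>F x in nhds a. x \<in> {-1<..<1}"
    using Suc.prems by (intro eventually_nhds_in_open) auto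
  then have "\<forall>\<^sub>F x in nhds a. (deriv ^^ n) g x =
      (Polygamma n ((3 + x) / 4) - (-1) ^ n * Polygamma n ((1 - x) / 4)) / 4 ^ Suc n"
    by eventually_elim (rule Suc.IH)
  then have "(deriv ^^ Suc n) g a = deriv (\<lambda>x.
      (Polygamma n ((3 + x) / 4) - (-1) ^ n * Polygamma n ((1 - x) / 4)) / 4 ^ Suc n) a"
    by (simp add: deriv_cong_ev)
  also have "\<dots> = (Polygamma (Suc n) ((3 + a) / 4)
      - (-1) ^ Suc n * Polygamma (Suc n) ((1 - a) / 4)) / 4 ^ Suc (Suc n)"
    using Suc.prems
    by (intro DERIV_imp_deriv)
       (auto intro!: derivative_eq_intros dest: nonpos_Ints_nonpos simp: field_simps)
  finally show ?case .
qed

theorem mainTheorem6: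
  fixes r :: nat and a :: real
  assumes "r \<ge> 1" and "a \<in> {-1<..<1}"
  shows "(\<lambda>n. series_term r a (Suc n)) sums (deriv ^^ (r - 1)) g a"
proof -
  define n where "n = r - 1"
  then have r: "r = Suc n" and n: "r - 1 = n"
    using \<open>r \<ge> 1\<close> by simp_all
  define x y where "x = (1 - a) / 4" and "y = (3 + a) / 4"
  have pos: "x > 0" "y > 0"
    using assms by (auto simp: x_def y_def)
  have sign: "((-1) :: real) ^ (r * (2 * m)) = 1" "((-1) :: real) ^ (r * (2 * m + 1)) = (-1) ^ r" for m
    by (simp_all add: power_mult power_add distrib_left mult.left_commute[of r 2])
  have odd_term: "series_term r a (Suc (2 * k)) =
      fact n / 4 ^ r * inverse ((x + of_nat k) ^ r)" for k
  proof -
    have denominator: "2 * real (Suc (2 * k)) - 1 + (-1) ^ Suc (2 * k) * a = 4 * (x + of_nat k)"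
      by (simp add: x_def field_simps)
    have exponent: "r * (Suc (2 * k) + 1) = r * (2 * (k + 1))"
      by simp
    show ?thesis
      unfolding series_term_def n denominator exponent sign power_mult_distrib
      by (simp add: divide_inverse)
  qed
  have even_term: "series_term r a (Suc (2 * k + 1)) =
      fact n / 4 ^ r * ((-1) ^ r * inverse ((y + of_nat k) ^ r))" for k
  proof -
    have denominator: "2 * real (Suc (2 * k + 1)) - 1 + (-1) ^ Suc (2 * k + 1) * a = 4 * (y + of_nat k)"
      by (simp add: y_def field_simps)
    have exponent: "r * (Suc (2 * k + 1) + 1) = r * (2 * (k + 1) + 1)"
      by simp
    show ?thesis
      unfolding series_term_def n denominator exponent sign power_mult_distrib
      by (simp add: divide_inverse)
  qed
  show ?thesis
  proof (rule sums_from_consecutive_pairs)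
    have "(\<lambda>k. fact n / 4 ^ r * (inverse ((x + of_nat k) ^ r)
              + (-1) ^ r * inverse ((y + of_nat k) ^ r)))
        sums (fact n / 4 ^ r * ((Polygamma n y - (-1) ^ n * Polygamma n x) / fact n))"
      unfolding r by (intro sums_mult paired_inverse_powers_sums pos)
    moreover have "fact n / 4 ^ r * ((Polygamma n y - (-1) ^ n * Polygamma n x) / fact n)
        = (deriv ^^ (r - 1)) g a"
      using higher_deriv_g[OF assms(2), of n] by (simp add: r x_def y_def)
    ultimately show "(\<lambda>k. series_term r a (Suc (2 * k)) + series_term r a (Suc (2 * k + 1)))
        sums (deriv ^^ (r - 1)) g a"
      by (simp only: odd_term even_term distrib_left)
    have "(\<lambda>k. inverse (x + real k)) \<longlonglongrightarrow> 0"
      by (intro tendsto_inverse_0_at_top filterlim_tendsto_add_at_top[OF tendsto_const]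
          filterlim_real_sequentially)
    then have "(\<lambda>k. fact n / 4 ^ r * inverse (x + real k) ^ r) \<longlonglongrightarrow> 0"
      using \<open>r \<ge> 1\<close> by (intro tendsto_mult_right_zero tendsto_null_power) auto
    then show "(\<lambda>k. series_term r a (Suc (2 * k))) \<longlonglongrightarrow> 0"
      by (simp only: odd_term power_inverse)
  qed
qed

end
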